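(* For every odd partition $\lambda$ with $|\lambda|>1$, there exists a unique odd partition $\mu\in\lambda^-$. In other words, the subgraph induced in Young's graph by the set $\Lambda^{\mathrm{odd}}$ of odd partitions is a rooted tree (rooted at $\emptyset$).
   Context: For a partition $\lambda$, $f_\lambda$ is the number of standard Young tableaux of shape $\lambda$ (equivalently the number of saturated chains from $\emptyset$ to $\lambda$ in Young's lattice); $\lambda$ is odd if $f_\lambda$ is odd, and $\Lambda^{\mathrm{odd}}$ is the set of odd partitions. Young's lattice is the set of partitions ordered by containment of Young diagrams, Young's graph its Hasse diagram. $\lambda^-$ denotes the set of partitions covered by $\lambda$ in Young's lattice (obtained by removing one cell). *)

theory Defs
  imports "HOL-Library.FuncSet" "Graph_Theory.Digraph_Component"
begin

definition partitions :: "nat list set" where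
  "partitions = {ps. sorted_wrt (\<ge>) ps \<and> (\<forall>k\<in>set ps. 0 < k)}"

text \<open>The size of a partition \<open>ps\<close> is \<open>sum_list ps\<close>; rows and columns are counted from 0.\<close>

definition young_diagram :: "nat list \<Rightarrow> (nat \<times> nat) set" where
  "young_diagram ps = {(i, j). i < length ps \<and> j < ps ! i}"

text \<open>Fillings are taken to be \<^const>\<open>undefined\<close> outside the diagram, so that each
  tableau is represented by exactly one function.\<close>

definition standard_young_tableaux :: "nat list \<Rightarrow> (nat \<times> nat \<Rightarrow> nat) set" where
  "standard_young_tableaux ps =
    {T \<in> extensional (young_diagram ps).
       bij_betw T (young_diagram ps) {1..sum_list ps} \<and>
       (\<forall>i j j'. (i, j) \<in> young_diagram ps \<longrightarrow> (i, j') \<in> young_diagram ps \<longrightarrow> j < j' \<longrightarrow>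
          T (i, j) < T (i, j')) \<and>
       (\<forall>i i' j. (i, j) \<in> young_diagram ps \<longrightarrow> (i', j) \<in> young_diagram ps \<longrightarrow> i < i' \<longrightarrow>
          T (i, j) < T (i', j))}"

definition num_syt :: "nat list \<Rightarrow> nat" where
  "num_syt ps = card (standard_young_tableaux ps)"

definition odd_partitions :: "nat list set" where
  "odd_partitions = {ps \<in> partitions. odd (num_syt ps)}"

definition young_less :: "nat list \<Rightarrow> nat list \<Rightarrow> bool" where
  "young_less qs ps \<longleftrightarrow> young_diagram qs \<subset> young_diagram ps"

definition lower_covers :: "nat list \<Rightarrow> nat list set" where
  "lower_covers ps =
    {qs \<in> partitions. young_less qs ps \<and>
       \<not> (\<exists>rs\<in>partitions. young_less qs rs \<and> young_less rs ps)}"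

text \<open>The undirected Hasse diagram, as a symmetric digraph: each edge gives both arcs.\<close>

definition young_graph :: "(nat list, nat list \<times> nat list) pre_digraph" where
  "young_graph =
    \<lparr> verts = partitions,
      arcs = {(ps, qs). ps \<in> partitions \<and> qs \<in> partitions \<and>
                (ps \<in> lower_covers qs \<or> qs \<in> lower_covers ps)},
      tail = fst, head = snd \<rparr>"

text \<open>Trees as simple undirected graphs, given as symmetric digraphs without loops and multiple
  arcs. \<^const>\<open>tree\<close> is not suitable for these, because \<^const>\<open>pre_digraph.cycle\<close> also holds for
  the walk \<open>u, v, u\<close> along a single edge. Genuine cycles are those of length at least 3.
  Trees may be infinite.\<close>

definition undirected_tree :: "('a, 'b) pre_digraph \<Rightarrow> bool" where
  "undirected_tree G \<longleftrightarrow>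
     sym_digraph G \<and> loopfree_digraph G \<and> nomulti_digraph G \<and> connected G \<and>
     \<not> (\<exists>p. pre_digraph.cycle G p \<and> 3 \<le> length p)"

definition rooted_tree :: "('a, 'b) pre_digraph \<Rightarrow> 'a \<Rightarrow> bool" where
  "rooted_tree G r \<longleftrightarrow> undirected_tree G \<and> r \<in> verts G"

end

theory Submission
  imports Defs "HOL-Library.Z2"
begin

text \<open>A partition with at most \<open>r\<close> parts is encoded by its set of \<open>r\<close> beta numbers, viewed as beads
  on a runner. Removing a rim hook of length \<open>q\<close> slides a bead from \<open>x\<close> to the free position
  \<open>x - q\<close>, and \<open>f\<^sub>\<lambda>\<close> counts the sequences of slides by 1 that lead to the empty partition. Modulo 2
  the operator summing over all slides by \<open>q\<close> squares to the one for \<open>2 * q\<close>. Hence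
  \<open>f\<^sub>\<lambda>\<close> is congruent to the sum of \<open>f\<^sub>\<mu>\<close> over all \<open>\<mu>\<close> obtained by removing a rim hook of length
  \<open>2 ^ k\<close>. If \<open>2 ^ k \<le> |\<lambda>| < 2 ^ (k + 1)\<close>, there is at most one such \<open>\<mu>\<close>, and for odd \<open>\<lambda>\<close> it exists and is
  odd. If \<open>\<mu>\<close> is empty, then \<open>\<lambda>\<close> is a hook with at most two lower covers, and the number of odd ones
  is odd. Otherwise removing the hook maps the odd lower covers of \<open>\<lambda>\<close> injectively to those
  of \<open>\<mu>\<close>, and induction applies.\<close>

section \<open>Bead configurations\<close>

definition slidable :: "nat \<Rightarrow> nat set \<Rightarrow> nat set" where
  "slidable q X = {x \<in> X. q \<le> x \<and> x - q \<notin> X}"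

definition slide :: "nat \<Rightarrow> nat \<Rightarrow> nat set \<Rightarrow> nat set" where
  "slide q x X = insert (x - q) (X - {x})"

text \<open>Values are taken in the two-element field \<open>bit\<close>, where contributions that
  come in equal pairs vanish.\<close>

definition slide_sum :: "nat \<Rightarrow> (nat set \<Rightarrow> bit) \<Rightarrow> nat set \<Rightarrow> bit" where
  "slide_sum q F X = (\<Sum>x\<in>slidable q X. F (slide q x X))"

lemma finite_slidable [simp]: "finite X \<Longrightarrow> finite (slidable q X)"
  by (simp add: slidable_def)

lemma finite_slide [simp]: "finite X \<Longrightarrow> finite (slide q x X)"
  by (simp add: slide_def)

lemma card_slide:
  assumes "finite X" "x \<in> slidable q X"
  shows "card (slide q x X) = card X"
proof -
  have "x \<in> X" "x - q \<notin> X" using assms(2) by (auto simp: slidable_def)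
  then show ?thesis
    using assms(1) unfolding slide_def
    by (metis Diff_iff card_Suc_Diff1 card_insert_disjoint finite_Diff)
qed

lemma sum_slide:
  assumes "finite X" "x \<in> slidable q X"
  shows "\<Sum>(slide q x X) + q = \<Sum>X"
proof -
  have x: "x \<in> X" "x - q \<notin> X" "q \<le> x" using assms(2) by (auto simp: slidable_def)
  have "\<Sum>(slide q x X) = (x - q) + \<Sum>(X - {x})"
    unfolding slide_def using x assms(1) by simp
  moreover have "\<Sum>X = x + \<Sum>(X - {x})"
    using x assms(1) by (simp add: sum.remove)
  ultimately show ?thesis using x by simp
qed

text \<open>The bead that moved is the only element of \<open>X\<close> missing from the
  result.\<close>

lemma slide_inject:
  assumes "x \<in> slidable q X" "y \<in> slidable q X" "slide q x X = slide q y X"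
  shows "x = y"
proof (rule ccontr)
  assume "x \<noteq> y"
  then have "y \<in> slide q x X" using assms by (auto simp: slide_def slidable_def)
  moreover have "y \<notin> slide q y X" using assms by (auto simp: slide_def slidable_def)
  ultimately show False using assms by simp
qed

lemma slide_sum_cong:
  assumes "finite X" "\<And>Y. finite Y \<Longrightarrow> F Y = G Y"
  shows "slide_sum q F X = slide_sum q G X"
  unfolding slide_sum_def using assms by (intro sum.cong) auto

section \<open>Slide operators modulo 2\<close>

lemma bit_add_self [simp]: "a + a = (0::bit)"
  by (cases a) auto

text \<open>The order splits the off-diagonal pairs into two halves that \<open>prod.swap\<close>
  exchanges; their equal sums cancel.\<close>

lemma sum_symmetric_bit:
  fixes g :: "'a::linorder \<times> 'a \<Rightarrow> bit"
  assumes "finite S" and sym: "\<And>x y. x \<in> S \<Longrightarrow> y \<in> S \<Longrightarrow> g (x, y) = g (y, x)"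
  shows "(\<Sum>p\<in>{p \<in> S \<times> S. fst p \<noteq> snd p}. g p) = 0"
proof -
  let ?L = "{p \<in> S \<times> S. fst p < snd p}" and ?G = "{p \<in> S \<times> S. snd p < fst p}"
  have fin: "finite (S \<times> S)" using assms by simp
  have "{p \<in> S \<times> S. fst p \<noteq> snd p} = ?L \<union> ?G" by auto
  then have "(\<Sum>p\<in>{p \<in> S \<times> S. fst p \<noteq> snd p}. g p) = sum g ?L + sum g ?G"
    using fin by (simp only:) (rule sum.union_disjoint; auto)
  also have "sum g ?G = sum g ?L"
    by (rule sum.reindex_bij_witness[of _ prod.swap prod.swap]) (auto intro: sym)
  finally show ?thesis by simp
qed

text \<open>Sliding two different beads can be done in either order, so these contributions cancel
  modulo 2. What remains is one bead sliding twice, or a bead sliding into the gap that its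
  neighbour at distance \<open>q\<close> has just left; both amount to a single slide by \<open>2 * q\<close>.\<close>

lemma slide_sum_twice:
  assumes "finite X" "0 < q"
  shows "slide_sum q (slide_sum q F) X = slide_sum (2 * q) F X"
proof -
  define S where "S = (SIGMA x:slidable q X. slidable q (slide q x X))"
  define g where "g = (\<lambda>(x, y). F (slide q y (slide q x X)))"
  \<comment> \<open>\<open>A\<close>: one bead slides twice. \<open>B\<close>: the bead at
    \<open>x - q\<close> makes room and \<open>x\<close> follows it. \<open>C\<close>: two beads
    that can each slide in \<open>X\<close>.\<close>
  define A where "A = (\<lambda>x. (x, x - q)) ` {x \<in> slidable (2 * q) X. x - q \<notin> X}"
  define B where "B = (\<lambda>x. (x - q, x)) ` {x \<in> slidable (2 * q) X. x - q \<in> X}"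
  define C where "C = {p \<in> slidable q X \<times> slidable q X. fst p \<noteq> snd p}"
  have "slide_sum q (slide_sum q F) X = sum g S"
    unfolding slide_sum_def S_def g_def using assms by (subst sum.Sigma) auto
  have S: "S = A \<union> B \<union> C"
  proof (rule set_eqI, clarify)
    fix x y
    have 1: "(x, y) \<in> A \<longleftrightarrow> y = x - q \<and> x \<in> X \<and> 2 * q \<le> x \<and> x - 2 * q \<notin> X \<and> x - q \<notin> X"
      by (auto simp: A_def slidable_def)
    have 2: "(x, y) \<in> B \<longleftrightarrow> x = y - q \<and> y \<in> X \<and> 2 * q \<le> y \<and> y - 2 * q \<notin> X \<and> y - q \<in> X"
      by (auto simp: B_def slidable_def)
    have 3: "(x, y) \<in> C \<longleftrightarrow> x \<noteq> y \<and> x \<in> X \<and> q \<le> x \<and> x - q \<notin> X \<and> y \<in> X \<and> q \<le> y \<and> y - q \<notin> X"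
      by (auto simp: C_def slidable_def)
    have 4: "(x, y) \<in> S \<longleftrightarrow> x \<in> X \<and> q \<le> x \<and> x - q \<notin> X \<and> (y = x - q \<or> y \<in> X \<and> y \<noteq> x)
        \<and> q \<le> y \<and> y - q \<noteq> x - q \<and> (y - q \<notin> X \<or> y - q = x)"
      by (auto simp: S_def slidable_def slide_def)
    have 5: "z - q - q = z - 2 * q" for z by simp
    show "(x, y) \<in> S \<longleftrightarrow> (x, y) \<in> A \<union> B \<union> C"
    \<comment> \<open>\<open>y = x - q\<close> leaves only \<open>A\<close>,
      \<open>x = y - q\<close> leaves only \<open>B\<close>, and every other pair can only lie in
      \<open>C\<close>.\<close>
    proof (cases "y = x - q")
      case True
      then show ?thesis unfolding Un_iff 1 2 3 4 using assms(2) 5[of x] by auto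
    next
      case False
      show ?thesis
      proof (cases "x = y - q")
        case True
        then show ?thesis unfolding Un_iff 1 2 3 4 using assms(2) 5[of y] by auto
      next
        case False
        with \<open>y \<noteq> x - q\<close> show ?thesis unfolding Un_iff 1 2 3 4 using assms(2)
          by (auto dest: eq_diff_iff[THEN iffD1, rotated 2])
      qed
    qed
  qed
  have fin: "finite A" "finite B" "finite C"
    using assms by (auto simp: A_def B_def C_def)
  have disj: "A \<inter> B = {}" "(A \<union> B) \<inter> C = {}"
    using assms by (auto simp: A_def B_def C_def slidable_def)
  have A: "sum g A = (\<Sum>x\<in>{x \<in> slidable (2 * q) X. x - q \<notin> X}. F (slide (2 * q) x X))"
    unfolding A_def
  proof (subst sum.reindex)
    show "inj_on (\<lambda>x. (x, x - q)) {x \<in> slidable (2 * q) X. x - q \<notin> X}" by (auto simp: inj_on_def)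
    have "slide q (x - q) (slide q x X) = slide (2 * q) x X"
      if "x \<in> slidable (2 * q) X" "x - q \<notin> X" for x
      using that assms by (auto simp: slide_def slidable_def mult_2)
    then show "sum (g \<circ> (\<lambda>x. (x, x - q))) {x \<in> slidable (2 * q) X. x - q \<notin> X} =
      (\<Sum>x\<in>{x \<in> slidable (2 * q) X. x - q \<notin> X}. F (slide (2 * q) x X))"
      by (intro sum.cong) (auto simp: g_def)
  qed
  have B: "sum g B = (\<Sum>x\<in>{x \<in> slidable (2 * q) X. x - q \<in> X}. F (slide (2 * q) x X))"
    unfolding B_def
  proof (subst sum.reindex)
    show "inj_on (\<lambda>x. (x - q, x)) {x \<in> slidable (2 * q) X. x - q \<in> X}" by (auto simp: inj_on_def)
    have "slide q x (slide q (x - q) X) = slide (2 * q) x X"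
      if "x \<in> slidable (2 * q) X" "x - q \<in> X" for x
      using that assms by (auto simp: slide_def slidable_def mult_2)
    then show "sum (g \<circ> (\<lambda>x. (x - q, x))) {x \<in> slidable (2 * q) X. x - q \<in> X} =
      (\<Sum>x\<in>{x \<in> slidable (2 * q) X. x - q \<in> X}. F (slide (2 * q) x X))"
      by (intro sum.cong) (auto simp: g_def)
  qed
  have C: "sum g C = 0"
    unfolding C_def
  proof (rule sum_symmetric_bit)
    show "g (x, y) = g (y, x)" if "x \<in> slidable q X" "y \<in> slidable q X" for x y
    proof -
      have "slide q y (slide q x X) = slide q x (slide q y X)"
        using that by (auto simp: slide_def slidable_def)
      then show ?thesis by (simp add: g_def)
    qed
  qed (use assms in auto)
  have "sum g S = sum g A + sum g B + sum g C"
    unfolding S using fin disj by (simp add: sum.union_disjoint)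
  also have "\<dots> = slide_sum (2 * q) F X"
  proof -
    have "slidable (2 * q) X = {x \<in> slidable (2 * q) X. x - q \<notin> X} \<union> {x \<in> slidable (2 * q) X. x - q \<in> X}"
      by auto
    then have "slide_sum (2 * q) F X = sum g A + sum g B"
      unfolding A B slide_sum_def using assms by (subst sum.union_disjoint[symmetric]) auto
    then show ?thesis using C by simp
  qed
  finally show ?thesis using \<open>slide_sum q (slide_sum q F) X = sum g S\<close> by simp
qed

text \<open>Doubling the exponent squares the operator, and squaring doubles the slide length by
  \<open>slide_sum_twice\<close>.\<close>

lemma slide_sum_funpow_power2:
  assumes "finite X"
  shows "(slide_sum 1 ^^ (2 ^ k)) F X = slide_sum (2 ^ k) F X"
  using assms
proof (induction k arbitrary: F X)
  case (Suc k)
  have "(slide_sum 1 ^^ (2 ^ Suc k)) F X = (slide_sum 1 ^^ (2 ^ k)) ((slide_sum 1 ^^ (2 ^ k)) F) X"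
    by (simp add: mult_2 funpow_add)
  also have "\<dots> = slide_sum (2 ^ k) ((slide_sum 1 ^^ (2 ^ k)) F) X"
    by (rule Suc.IH[OF Suc.prems])
  also have "\<dots> = slide_sum (2 ^ k) (slide_sum (2 ^ k) F) X"
    by (intro slide_sum_cong Suc.prems Suc.IH)
  also have "\<dots> = slide_sum (2 ^ Suc k) F X"
    using slide_sum_twice[OF Suc.prems, of "2 ^ k"] by simp
  finally show ?case .
qed simp

section \<open>Size and parity of a configuration\<close>

text \<open>A set of \<open>Suc n\<close> naturals has maximum at least \<open>n\<close>; removing
  it leaves the induction hypothesis. Equality must then hold in both estimates.\<close>

lemma sum_lessThan_card_le:
  fixes X :: "nat set"
  assumes "finite X"
  shows "\<Sum>{..<card X} \<le> \<Sum>X \<and> (\<Sum>X = \<Sum>{..<card X} \<longrightarrow> X = {..<card X})"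
  using assms
proof (induction "card X" arbitrary: X)
  case (Suc n)
  define M where "M = Max X"
  have M: "M \<in> X" "X \<subseteq> {..M}" using Suc by (auto simp: M_def intro: Max_in)
  have "card X \<le> card {..M}" using M by (intro card_mono) auto
  then have nM: "n \<le> M" using Suc.hyps by simp
  have "card (X - {M}) = n" using Suc M by simp
  then have IH: "\<Sum>{..<n} \<le> \<Sum>(X - {M})" "\<Sum>(X - {M}) = \<Sum>{..<n} \<Longrightarrow> X - {M} = {..<n}"
    using Suc.hyps(1)[of "X - {M}"] Suc.prems by auto
  have "\<Sum>X = M + \<Sum>(X - {M})" using M Suc.prems by (simp add: sum.remove)
  moreover have "\<Sum>{..<card X} = n + \<Sum>{..<n}" by (simp flip: Suc.hyps(2))
  moreover have "X = {..<card X}" if "M = n" "X - {M} = {..<n}"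
  proof -
    have "X = insert n {..<n}" using that M by blast
    then show ?thesis by (simp flip: Suc.hyps(2) add: lessThan_Suc)
  qed
  ultimately show ?case using IH nM by auto
qed simp

text \<open>The excess of the bead sum over its minimum, which is the size of the encoded partition
  whatever the number of beads.\<close>

definition bead_size :: "nat set \<Rightarrow> nat" where
  "bead_size X = \<Sum>X - \<Sum>{..<card X}"

text \<open>Counts modulo 2 the sequences of unit slides down to an initial segment, which encodes
  the empty partition.\<close>

definition bead_parity :: "nat set \<Rightarrow> bit" where
  "bead_parity X = (slide_sum 1 ^^ bead_size X) (\<lambda>Y. of_bool (Y = {..<card Y})) X"

text \<open>The number of beads is kept and their sum drops by \<open>q\<close>; minimality of the
  initial segment keeps the truncated subtraction exact.\<close>

lemma bead_size_slide:
  assumes "finite X" "x \<in> slidable q X"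
  shows "bead_size (slide q x X) + q = bead_size X"
  using sum_slide[OF assms] card_slide[OF assms] sum_lessThan_card_le[of "slide q x X"] assms
  by (simp add: bead_size_def)

lemma bead_size_eq_0:
  assumes "finite X" "bead_size X = 0"
  shows "X = {..<card X}"
  using sum_lessThan_card_le[OF assms(1)] assms(2) by (simp add: bead_size_def)

text \<open>The first \<open>2 ^ k\<close> unit slides merge into one long slide, and the remaining
  ones compute the parity of the configuration reached. For \<open>k = 0\<close> this is the
  recursion over unit slides.\<close>

lemma bead_parity_power2:
  assumes "finite X" "2 ^ k \<le> bead_size X"
  shows "bead_parity X = slide_sum (2 ^ k) bead_parity X"
proof -
  let ?\<delta> = "\<lambda>Y. of_bool (Y = {..<card Y}) :: bit"
  define m where "m = bead_size X - 2 ^ k"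
  have n: "bead_size X = 2 ^ k + m" using assms by (simp add: m_def)
  have "bead_parity X = (slide_sum 1 ^^ (2 ^ k)) ((slide_sum 1 ^^ m) ?\<delta>) X"
    by (simp add: bead_parity_def n funpow_add)
  also have "\<dots> = slide_sum (2 ^ k) ((slide_sum 1 ^^ m) ?\<delta>) X"
    by (rule slide_sum_funpow_power2[OF assms(1)])
  also have "\<dots> = slide_sum (2 ^ k) bead_parity X"
    unfolding slide_sum_def[of "2 ^ k"]
  proof (rule sum.cong)
    fix x assume "x \<in> slidable (2 ^ k) X"
    then have "bead_size (slide (2 ^ k) x X) = m"
      using bead_size_slide[OF assms(1), of x "2 ^ k"] n by simp
    then show "(slide_sum 1 ^^ m) ?\<delta> (slide (2 ^ k) x X) = bead_parity (slide (2 ^ k) x X)"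
      by (simp add: bead_parity_def)
  qed simp
  finally show ?thesis .
qed

section \<open>Exchanging unit slides with long slides\<close>

text \<open>After the slide of one bead the other could still slide, at a total cost of
  \<open>2 * q\<close>.\<close>

lemma slidable_unique:
  assumes "finite X" "bead_size X < 2 * q" "x \<in> slidable q X" "y \<in> slidable q X"
  shows "x = y"
proof (rule ccontr)
  assume "x \<noteq> y"
  then have "y \<in> slidable q (slide q x X)"
    using assms by (auto simp: slidable_def slide_def)
  then show False
    using bead_size_slide[OF assms(1,3)] bead_size_slide[of "slide q x X" y q] assms by simp
qed

text \<open>In \<open>slide 1 x X\<close> the bead \<open>y\<close> slides by \<open>q\<close>. Exchanging the two slides can only fail when
  a bead \<open>z\<close> goes to \<open>z - q - 1\<close> although neither \<open>z - q\<close> is free nor \<open>z - 1\<close> is occupied, and then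
  the bead \<open>x0\<close> could still slide by \<open>q\<close> afterwards, which the size forbids.\<close>

lemma slide_1_slide_cases:
  assumes fin: "finite X" and size: "bead_size X < 2 * q" and q: "0 < q"
    and x0: "x0 \<in> slidable q X" and x: "x \<in> slidable 1 X" and y: "y \<in> slidable q (slide 1 x X)"
  obtains
    (commute) "x \<in> slidable 1 (slide q x0 X)"
      "slide q y (slide 1 x X) = slide 1 x (slide q x0 X)"
  | (above) "x = x0 + 1 - q" "x0 + 1 \<in> slidable 1 (slide q x0 X)"
      "slide q y (slide 1 x X) = slide 1 (x0 + 1) (slide q x0 X)"
  | (below) "x = x0" "x0 - q \<in> slidable 1 (slide q x0 X)"
      "slide q y (slide 1 x X) = slide 1 (x0 - q) (slide q x0 X)"
proof -
  define Z where "Z = slide q y (slide 1 x X)"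
  define X' where "X' = slide q x0 X"
  note goals = commute[folded Z_def X'_def] above[folded Z_def X'_def] below[folded Z_def X'_def]
  have X: "x \<in> X" "1 \<le> x" "x - 1 \<notin> X" using x by (auto simp: slidable_def)
  have X0: "x0 \<in> X" "q \<le> x0" "x0 - q \<notin> X" using x0 by (auto simp: slidable_def)
  have Y: "y = x - 1 \<or> y \<in> X \<and> y \<noteq> x" "q \<le> y" "y - q \<noteq> x - 1" "y - q \<notin> X \<or> y - q = x"
    using y by (auto simp: slidable_def slide_def)
  \<comment> \<open>The two slides cost \<open>q + 1\<close> out of less than \<open>2 * q\<close>,
    so \<open>Z\<close> admits no further slide by \<open>q\<close>.\<close>
  have sz: "bead_size Z < q"
    using bead_size_slide[OF fin x] bead_size_slide[OF _ y] fin size by (simp add: Z_def)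
  have uniq: "z = x0" if "z \<in> slidable q X" for z
    using slidable_unique[OF fin size that x0] .
  have no: "False" if "z \<in> X" "q + 1 \<le> z" "z - q \<in> X" "z - 1 \<notin> X" "Z = insert (z - q - 1) (X - {z})" for z
  proof -
    \<comment> \<open>\<open>z - q\<close> is occupied but \<open>x0 - q\<close> is free;
      \<open>z - 1\<close> is free but \<open>x0\<close> is occupied. So \<open>x0\<close> stays in
      place in \<open>Z\<close>, and its target is not the new bead.\<close>
    have "x0 \<noteq> z" using X0 that by auto
    moreover have "x0 \<noteq> z - 1" using X0 that by auto
    then have "x0 - q \<noteq> z - q - 1" using X0(2) that(2) by linarith
    ultimately have "x0 \<in> slidable q Z"
      using X0 that by (auto simp: slidable_def)
    then show False using bead_size_slide[of Z x0 q] sz fin by (simp add: Z_def)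
  qed
  \<comment> \<open>The long slide moves the bead just slid, or fills the gap left at
    \<open>x\<close>, or was already possible in \<open>X\<close>.\<close>
  consider "y = x - 1" | "y \<in> X" "y \<noteq> x" "y - q = x" | "y \<in> X" "y \<noteq> x" "y - q \<notin> X"
    using Y by blast
  then show ?thesis
  proof cases
    case 1
    then have Z: "Z = insert (x - q - 1) (X - {x})"
      using X Y by (auto simp: Z_def slide_def)
    have q1: "q + 1 \<le> x" using 1 Y X by simp
    have nx: "x - q - 1 \<notin> X" using 1 Y X by (auto simp: diff_commute)
    show ?thesis
    proof (cases "x - q \<in> X")
      case True
      then show ?thesis using no[of x] X q1 Z by auto
    next
      case False
      \<comment> \<open>With \<open>x - q\<close> free, the bead could make the long slide first and
        the unit slide afterwards.\<close>
      then have "x = x0" using uniq[of x] X q1 by (auto simp: slidable_def)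
      moreover from this have "x0 - q \<in> slidable 1 X'"
        using nx q1 q by (auto simp: slidable_def X'_def slide_def)
      moreover have "Z = slide 1 (x0 - q) X'"
        using Z \<open>x = x0\<close> X0 q q1 by (auto simp: X'_def slide_def)
      ultimately show ?thesis using goals(3) by blast
    qed
  next
    case 2
    then have Z: "Z = insert (y - q - 1) (X - {y})"
      using X Y q by (auto simp: Z_def slide_def)
    have q1: "q + 1 \<le> y" using 2 X by simp
    \<comment> \<open>The bead at \<open>y - 1\<close> can slide by \<open>q\<close> to the free
      position \<open>x - 1\<close>, so it is \<open>x0\<close>. In the other order
      \<open>x0\<close> slides there first, and \<open>y\<close> then steps into its place.\<close>
    have "y - 1 \<in> X" using no[of y] 2 X q1 Z by auto
    then have "y - 1 = x0"
      using uniq[of "y - 1"] 2 X q1 by (auto simp: slidable_def)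
    then have y: "y = x0 + 1" using q1 by simp
    then have "x0 + 1 \<in> slidable 1 X'"
      using 2(1) q X0(2) by (auto simp: slidable_def X'_def slide_def)
    moreover have "Z = slide 1 (x0 + 1) X'"
      using Z X0 y 2 q by (auto simp: X'_def slide_def)
    ultimately show ?thesis using goals(2) y 2 by auto
  next
    case 3
    then have "y = x0" using uniq[of y] Y by (auto simp: slidable_def)
    moreover from this have "x \<in> slidable 1 X'"
      using 3 X Y by (auto simp: slidable_def X'_def slide_def)
    moreover have "Z = slide 1 x X'"
      using 3 \<open>y = x0\<close> X Y by (auto simp: Z_def X'_def slide_def)
    ultimately show ?thesis using goals(1) by blast
  qed
qed

text \<open>By the exchange cases, the common result is a unit slide of a bead \<open>x\<close>,
  \<open>x0 + 1\<close> or \<open>x0 - q\<close> in \<open>slide q x0 X\<close>, and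
  \<open>slide_inject\<close> identifies the beads for \<open>x\<close> and \<open>x'\<close>. Mixed
  cases fail: the position below \<open>x0 + 1\<close> is occupied, and \<open>x0 - q\<close> is
  free in \<open>X\<close>.\<close>

lemma slide_1_slide_inject:
  assumes fin: "finite X" and size: "bead_size X < 2 * q" and q: "0 < q"
    and x0: "x0 \<in> slidable q X" and x: "x \<in> slidable 1 X" and x': "x' \<in> slidable 1 X"
    and y: "y \<in> slidable q (slide 1 x X)" and y': "y' \<in> slidable q (slide 1 x' X)"
    and eq: "slide q y (slide 1 x X) = slide q y' (slide 1 x' X)"
  shows "x = x'"
proof -
  have X0: "x0 \<in> X" "q \<le> x0" "x0 - q \<notin> X" using x0 by (auto simp: slidable_def)
  have X: "x \<in> X" "x - 1 \<notin> X" "x' \<in> X" "x' - 1 \<notin> X" using x x' by (auto simp: slidable_def)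
  note inj = slide_inject[where q = 1 and X = "slide q x0 X"]
  show ?thesis
  proof (cases rule: slide_1_slide_cases[OF fin size q x0 x y, case_names commute above below])
    case commute
    note 1 = this
    show ?thesis
    proof (cases rule: slide_1_slide_cases[OF fin size q x0 x' y', case_names commute above below])
      case commute then show ?thesis using inj 1 eq by metis
    next
      case above then have "x = x0 + 1" using inj 1 eq by metis
      then show ?thesis using X X0 by simp
    next
      case below then have "x = x0 - q" using inj 1 eq by metis
      then show ?thesis using X X0 by simp
    qed
  next
    case above
    note 1 = this
    show ?thesis
    proof (cases rule: slide_1_slide_cases[OF fin size q x0 x' y', case_names commute above below])
      case commute then have "x' = x0 + 1" using inj 1 eq by metis
      then show ?thesis using X X0 by simp
    next
      case above then show ?thesis using 1 by simp
    next
      case below then have "x0 + 1 = x0 - q" using inj 1 eq by metis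
      then show ?thesis using X0 by simp
    qed
  next
    case below
    note 1 = this
    show ?thesis
    proof (cases rule: slide_1_slide_cases[OF fin size q x0 x' y', case_names commute above below])
      case commute then have "x' = x0 - q" using inj 1 eq by metis
      then show ?thesis using X X0 by simp
    next
      case above then have "x0 + 1 = x0 - q" using inj 1 eq by metis
      then show ?thesis using X0 by simp
    next
      case below then show ?thesis using 1 by simp
    qed
  qed
qed

section \<open>The unique odd unit slide\<close>

lemma slide_sum_eq_1E:
  assumes "slide_sum q F X = 1"
  obtains x where "x \<in> slidable q X" "F (slide q x X) = 1"
proof (rule ccontr)
  assume "\<not> thesis"
  then have "\<forall>x\<in>slidable q X. F (slide q x X) = 0" using that bit_not_one_iff by blast
  then have "slide_sum q F X = 0" unfolding slide_sum_def by (rule sum.neutral)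
  then show False using assms by simp
qed

text \<open>Existence is the recursion over unit slides modulo 2. Uniqueness is pulled back along a
  long slide from a smaller configuration.\<close>

lemma bead_parity_slide_1_ex1:
  assumes "finite X" "0 < bead_size X" "bead_parity X = 1"
  shows "\<exists>!x. x \<in> slidable 1 X \<and> bead_parity (slide 1 x X) = 1"
  using assms
proof (induction "bead_size X" arbitrary: X rule: less_induct)
  case less
  note fin = less.prems(1)
  have "bead_parity X = slide_sum 1 bead_parity X"
    using bead_parity_power2[of X 0] less.prems by simp
  then obtain x where x: "x \<in> slidable 1 X" "bead_parity (slide 1 x X) = 1"
    using slide_sum_eq_1E less.prems(3) by metis
  \<comment> \<open>\<open>q\<close> is the largest power of two not above the size, so
    \<open>bead_size X < 2 * q\<close> leaves at most one slide by \<open>q\<close>.\<close>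
  obtain k where k: "2 ^ k \<le> bead_size X" "bead_size X < 2 ^ Suc k"
    using ex_power_ivl1[of 2 "bead_size X"] less.prems by auto
  define q :: nat where "q = 2 ^ k"
  have q: "0 < q" "q \<le> bead_size X" "bead_size X < 2 * q" using k by (auto simp: q_def)
  have step: "\<exists>y. y \<in> slidable q Y \<and> bead_parity (slide q y Y) = 1"
    if "finite Y" "q \<le> bead_size Y" "bead_parity Y = 1" for Y
    using bead_parity_power2[of Y k] that slide_sum_eq_1E[of q bead_parity Y] by (auto simp: q_def)
  obtain x0 where x0: "x0 \<in> slidable q X" "bead_parity (slide q x0 X) = 1"
    using step less.prems q by blast
  have size': "bead_size (slide q x0 X) + q = bead_size X" by (rule bead_size_slide[OF fin x0(1)])
  have "x' = x" if x': "x' \<in> slidable 1 X" "bead_parity (slide 1 x' X) = 1" for x'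
  proof (cases "bead_size X = q")
    case True
    text \<open>A hook has at most two lower covers, and the number of odd ones is odd.\<close>
    then obtain r where r: "slide q x0 X = {..<r}"
      using bead_size_eq_0[of "slide q x0 X"] size' fin by auto
    \<comment> \<open>\<open>X\<close> is an initial segment whose bead at \<open>x0 - q\<close> was
      raised to \<open>x0\<close>; a bead other than \<open>x0\<close> can only step into that one
      gap.\<close>
    have "z = x0 \<or> z = x0 - q + 1" if z: "z \<in> slidable 1 X" for z
    proof (rule ccontr)
      assume c: "\<not> (z = x0 \<or> z = x0 - q + 1)"
      have "z \<in> {..<r}" using z c unfolding r[symmetric] by (auto simp: slidable_def slide_def)
      then have "z - 1 \<in> slide q x0 X" using r by auto
      then show False using z c by (auto simp: slidable_def slide_def)
    qed
    then have sub: "slidable 1 X \<subseteq> {x0, x0 - q + 1}" by auto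
    show ?thesis
    proof (rule ccontr)
      assume "x' \<noteq> x"
      then have "slidable 1 X = {x, x'}" using sub x x' by auto
      then have "slide_sum 1 bead_parity X = 0"
        using \<open>x' \<noteq> x\<close> x x' by (simp add: slide_sum_def)
      then show False using \<open>bead_parity X = slide_sum 1 bead_parity X\<close> less.prems by simp
    qed
  next
    case False
    then have pos: "0 < bead_size (slide q x0 X)" using size' q by simp
    have IH: "\<exists>!z. z \<in> slidable 1 (slide q x0 X) \<and> bead_parity (slide 1 z (slide q x0 X)) = 1"
      using less.hyps[of "slide q x0 X"] size' q pos x0 fin by simp
    \<comment> \<open>The size exceeds \<open>q\<close>, so an odd slide by \<open>q\<close> remains
      after the unit slide; exchanging the two gives an odd unit slide of
      \<open>slide q x0 X\<close>.\<close>
    have *: "\<exists>y z. y \<in> slidable q (slide 1 w X) \<and> z \<in> slidable 1 (slide q x0 X) \<and>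
        bead_parity (slide 1 z (slide q x0 X)) = 1 \<and>
        slide q y (slide 1 w X) = slide 1 z (slide q x0 X)"
      if w: "w \<in> slidable 1 X" "bead_parity (slide 1 w X) = 1" for w
    proof -
      have "q \<le> bead_size (slide 1 w X)"
        using bead_size_slide[OF fin w(1)] False q by simp
      then obtain y where y: "y \<in> slidable q (slide 1 w X)" "bead_parity (slide q y (slide 1 w X)) = 1"
        using step[of "slide 1 w X"] w fin by auto
      show ?thesis
        using slide_1_slide_cases[OF fin q(3,1) x0(1) w(1) y(1)] y by metis
    qed
    \<comment> \<open>By \<open>IH\<close> both unit slides lead to the same configuration, and
      injectivity of the exchange gives \<open>x' = x\<close>.\<close>
    show ?thesis
      using *[OF x] *[OF x'] IH slide_1_slide_inject[OF fin q(3,1) x0(1) x(1) x'(1)] by metis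
  qed
  then show ?case using x by blast
qed

section \<open>Partitions and standard Young tableaux\<close>

text \<open>Padding with zeros turns containment into a pointwise comparison, without cases on the
  lengths.\<close>

definition row :: "nat list \<Rightarrow> nat \<Rightarrow> nat" where
  "row ps i = (if i < length ps then ps ! i else 0)"

lemma mem_young_diagram: "(i, j) \<in> young_diagram ps \<longleftrightarrow> j < row ps i"
  by (auto simp: young_diagram_def row_def)

lemma young_diagram_subset_iff: "young_diagram qs \<subseteq> young_diagram ps \<longleftrightarrow> (\<forall>i. row qs i \<le> row ps i)"
proof
  assume *: "young_diagram qs \<subseteq> young_diagram ps"
  show "\<forall>i. row qs i \<le> row ps i"
  proof (rule allI, rule ccontr)
    fix i assume "\<not> row qs i \<le> row ps i"
    then have "(i, row ps i) \<in> young_diagram qs" by (simp add: mem_young_diagram)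
    then have "(i, row ps i) \<in> young_diagram ps" using * by blast
    then show False by (simp add: mem_young_diagram)
  qed
next
  assume "\<forall>i. row qs i \<le> row ps i"
  then show "young_diagram qs \<subseteq> young_diagram ps"
    by (auto simp: mem_young_diagram) (metis less_le_trans)
qed

lemma young_diagram_eq_Sigma: "young_diagram ps = (SIGMA i:{..<length ps}. {..<ps ! i})"
  by (auto simp: young_diagram_def)

lemma finite_young_diagram [simp]: "finite (young_diagram ps)"
  by (simp add: young_diagram_eq_Sigma)

lemma card_young_diagram: "card (young_diagram ps) = sum_list ps"
  by (simp add: young_diagram_eq_Sigma sum_list_sum_nth atLeast0LessThan)

lemma row_antimono:
  assumes "ps \<in> partitions" "i \<le> j"
  shows "row ps j \<le> row ps i"
  using assms by (cases "i = j") (auto simp: partitions_def row_def sorted_wrt_iff_nth_less)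

lemma row_eq_0_iff:
  assumes "ps \<in> partitions"
  shows "row ps i = 0 \<longleftrightarrow> length ps \<le> i"
  using assms by (force simp: partitions_def row_def)

text \<open>Parts are positive, so the length is the index of the first zero row.\<close>

lemma row_inject:
  assumes "ps \<in> partitions" "qs \<in> partitions" "row ps = row qs"
  shows "ps = qs"
proof -
  have "length ps \<le> i \<longleftrightarrow> length qs \<le> i" for i
    using row_eq_0_iff[OF assms(1), of i] row_eq_0_iff[OF assms(2), of i] assms(3) by simp
  then have len: "length ps = length qs" by (meson le_antisym order_refl)
  have "ps ! i = qs ! i" if "i < length ps" for i
    using fun_cong[OF assms(3), of i] that len by (simp add: row_def)
  then show ?thesis using len by (intro nth_equalityI) auto
qed

lemma young_diagram_inject:
  assumes "ps \<in> partitions" "qs \<in> partitions" "young_diagram ps = young_diagram qs"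
  shows "ps = qs"
  using assms young_diagram_subset_iff[of ps qs] young_diagram_subset_iff[of qs ps]
  by (intro row_inject) (auto intro!: ext antisym)

text \<open>Cutting just before the first zero keeps only positive parts, and antitonicity makes
  everything after it vanish.\<close>

lemma partition_with_rows_exists:
  assumes "\<And>i. f (Suc i) \<le> f i" "f r = 0"
  shows "\<exists>ps\<in>partitions. row ps = f"
proof -
  define n where "n = (LEAST i. f i = 0)"
  have n: "f n = 0" unfolding n_def using assms(2) by (rule LeastI)
  have pos: "0 < f i" if "i < n" for i
    using not_less_Least that unfolding n_def by blast
  have anti: "f j \<le> f i" if "i \<le> j" for i j
    using lift_Suc_antimono_le[of f] assms(1) that by blast
  have "map f [0..<n] \<in> partitions"
    using anti pos by (auto simp: partitions_def sorted_wrt_iff_nth_less)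
  moreover have "row (map f [0..<n]) = f"
    using anti[of n] n by (auto simp: row_def fun_eq_iff)
  ultimately show ?thesis by blast
qed

section \<open>Corners and lower covers\<close>

definition corner_rows :: "nat list \<Rightarrow> nat set" where
  "corner_rows ps = {i. row ps (Suc i) < row ps i}"

text \<open>Specified by its rows because a part 1 that becomes 0 has to disappear from the list;
  \<open>row_inject\<close> makes the choice unique.\<close>

definition remove_corner :: "nat list \<Rightarrow> nat \<Rightarrow> nat list" where
  "remove_corner ps i = (SOME qs. qs \<in> partitions \<and> row qs = (row ps)(i := row ps i - 1))"

lemma corner_rows_subset: "corner_rows ps \<subseteq> {..<length ps}"
  by (auto simp: corner_rows_def row_def split: if_splits)

lemma finite_corner_rows [simp]: "finite (corner_rows ps)"
  using corner_rows_subset finite_subset by blast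

lemma remove_corner:
  assumes "ps \<in> partitions" "i \<in> corner_rows ps"
  shows remove_corner_partition: "remove_corner ps i \<in> partitions"
    and row_remove_corner: "row (remove_corner ps i) = (row ps)(i := row ps i - 1)"
proof -
  let ?f = "(row ps)(i := row ps i - 1)"
  have "?f (Suc j) \<le> ?f j" for j
    using assms(2) row_antimono[OF assms(1), of j "Suc j"] by (auto simp: corner_rows_def)
  moreover have "?f (length ps) = 0" by (simp add: row_def)
  ultimately have "\<exists>qs. qs \<in> partitions \<and> row qs = ?f"
    using partition_with_rows_exists[of ?f] by blast
  from someI_ex[OF this] show "remove_corner ps i \<in> partitions" "row (remove_corner ps i) = ?f"
    by (auto simp: remove_corner_def)
qed

lemma young_diagram_remove_corner:
  assumes "ps \<in> partitions" "i \<in> corner_rows ps"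
  shows "young_diagram ps = insert (i, row ps i - 1) (young_diagram (remove_corner ps i))"
    and "(i, row ps i - 1) \<notin> young_diagram (remove_corner ps i)"
  using assms(2)
  by (auto simp: mem_young_diagram row_remove_corner[OF assms] corner_rows_def split: if_splits)

lemma sum_list_remove_corner:
  assumes "ps \<in> partitions" "i \<in> corner_rows ps"
  shows "sum_list ps = Suc (sum_list (remove_corner ps i))"
  using young_diagram_remove_corner[OF assms] by (simp flip: card_young_diagram)

text \<open>Any smaller partition still fits after the removal of a suitable corner, so a lower
  cover must equal the result.\<close>

lemma lower_covers_eq:
  assumes "ps \<in> partitions"
  shows "lower_covers ps = remove_corner ps ` corner_rows ps"
proof (intro equalityI subsetI)
  fix qs assume "qs \<in> lower_covers ps"
  then have qs: "qs \<in> partitions" "young_diagram qs \<subset> young_diagram ps"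
    and cov: "\<And>rs. rs \<in> partitions \<Longrightarrow> young_diagram qs \<subset> young_diagram rs \<Longrightarrow>
      \<not> young_diagram rs \<subset> young_diagram ps"
    by (auto simp: lower_covers_def young_less_def)
  have le: "row qs i \<le> row ps i" for i using qs young_diagram_subset_iff by blast
  define S where "S = {i. row qs i < row ps i}"
  have "S \<subseteq> {..<length ps}" by (auto simp: S_def row_def split: if_splits)
  then have finS: "finite S" using finite_subset by blast
  have "\<not> young_diagram ps \<subseteq> young_diagram qs" using qs by blast
  then have "S \<noteq> {}" unfolding young_diagram_subset_iff S_def by (auto simp: not_le)
  \<comment> \<open>Row \<open>Suc i\<close> is not shortened, so \<open>row ps (Suc i) \<le> row qs
    (Suc i) \<le> row qs i < row ps i\<close> makes \<open>i\<close> a corner row.\<close>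
  define i where "i = Max S"
  have i: "row qs i < row ps i" using Max_in[OF finS \<open>S \<noteq> {}\<close>] by (simp add: i_def S_def)
  have "Suc i \<notin> S" using Max_ge[OF finS, of "Suc i"] by (auto simp: i_def)
  then have "row ps (Suc i) \<le> row qs (Suc i)" by (simp add: S_def)
  also have "\<dots> \<le> row qs i" by (simp add: row_antimono[OF qs(1)])
  finally have c: "i \<in> corner_rows ps" using i by (simp add: corner_rows_def)
  let ?rs = "remove_corner ps i"
  have "young_diagram qs \<subseteq> young_diagram ?rs"
    unfolding young_diagram_subset_iff row_remove_corner[OF assms c] using i le by auto
  moreover have "young_diagram ?rs \<subset> young_diagram ps"
    using young_diagram_remove_corner[OF assms c] by blast
  ultimately have "young_diagram qs = young_diagram ?rs"
    using cov[OF remove_corner_partition[OF assms c]] by blast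
  then have "qs = ?rs"
    using young_diagram_inject qs(1) remove_corner_partition[OF assms c] by blast
  then show "qs \<in> remove_corner ps ` corner_rows ps" using c by blast
next
  fix qs assume "qs \<in> remove_corner ps ` corner_rows ps"
  then obtain i where c: "i \<in> corner_rows ps" "qs = remove_corner ps i" by blast
  \<comment> \<open>The diagrams differ in a single cell, so nothing lies strictly between
    them.\<close>
  then show "qs \<in> lower_covers ps"
    using remove_corner_partition[OF assms c(1)] young_diagram_remove_corner[OF assms c(1)]
    by (auto simp: lower_covers_def young_less_def)
qed

section \<open>Branching rule for standard tableaux\<close>

lemma finite_standard_young_tableaux [simp]: "finite (standard_young_tableaux ps)"
proof (rule finite_subset)
  show "standard_young_tableaux ps \<subseteq> young_diagram ps \<rightarrow>\<^sub>E {1..sum_list ps}"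
    by (auto simp: standard_young_tableaux_def PiE_def bij_betw_def)
  show "finite (young_diagram ps \<rightarrow>\<^sub>E {1..sum_list ps})"
    by (intro finite_PiE) auto
qed

text \<open>Erasing the largest entry and writing it back are inverse operations, since no cell lies
  beyond the corner.\<close>

lemma standard_young_tableaux_corner:
  assumes ps: "ps \<in> partitions" and i: "i \<in> corner_rows ps"
  defines "c \<equiv> (i, row ps i - 1)" and "qs \<equiv> remove_corner ps i"
  shows "{T \<in> standard_young_tableaux ps. T c = sum_list ps} =
    (\<lambda>T. T(c := sum_list ps)) ` standard_young_tableaux qs"
proof -
  have D: "young_diagram ps = insert c (young_diagram qs)" "c \<notin> young_diagram qs"
    using young_diagram_remove_corner[OF ps i] by (auto simp: c_def qs_def)
  have n: "sum_list ps = Suc (sum_list qs)"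
    using sum_list_remove_corner[OF ps i] by (simp add: qs_def)
  \<comment> \<open>The other cells in the row of \<open>c\<close> lie to its left and those in its
    column above it, so the largest entry at \<open>c\<close> respects both orders.\<close>
  have c_max: "j < snd c" if "(fst c, j) \<in> young_diagram qs" for j
    using that row_remove_corner[OF ps i] by (simp add: c_def qs_def mem_young_diagram)
  have c_max': "i' < fst c" if "(i', snd c) \<in> young_diagram qs" for i'
  proof (rule ccontr)
    assume "\<not> i' < fst c"
    moreover have "i' \<noteq> fst c" using that D(2) by auto
    ultimately have "Suc i \<le> i'" by (simp add: c_def)
    then have "row ps i' \<le> row ps (Suc i)" by (rule row_antimono[OF ps])
    moreover have "row ps i - 1 < row ps i'"
      using that D(1) by (auto simp: c_def simp flip: mem_young_diagram)
    ultimately show False using i by (auto simp: corner_rows_def)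
  qed
  show ?thesis
  proof (intro equalityI subsetI)
    fix T assume "T \<in> {T \<in> standard_young_tableaux ps. T c = sum_list ps}"
    then have T: "T \<in> extensional (young_diagram ps)" "bij_betw T (young_diagram ps) {1..sum_list ps}"
      "\<And>i j j'. (i, j) \<in> young_diagram ps \<Longrightarrow> (i, j') \<in> young_diagram ps \<Longrightarrow> j < j' \<Longrightarrow> T (i, j) < T (i, j')"
      "\<And>i i' j. (i, j) \<in> young_diagram ps \<Longrightarrow> (i', j) \<in> young_diagram ps \<Longrightarrow> i < i' \<Longrightarrow> T (i, j) < T (i', j)"
      and Tc: "T c = sum_list ps"
      by (auto simp: standard_young_tableaux_def)
    let ?U = "restrict T (young_diagram qs)"
    have "bij_betw T (young_diagram qs) {1..sum_list qs}"
    proof -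
      have "bij_betw T (young_diagram ps - {c}) ({1..sum_list ps} - {sum_list ps})"
        using T(2) D Tc n by (intro bij_betw_DiffI) (auto simp: bij_betw_def)
      moreover have "young_diagram ps - {c} = young_diagram qs" using D by auto
      moreover have "{1..sum_list ps} - {sum_list ps} = {1..sum_list qs}" using n by auto
      ultimately show ?thesis by simp
    qed
    then have "bij_betw ?U (young_diagram qs) {1..sum_list qs}"
      by (simp cong: bij_betw_cong)
    then have "?U \<in> standard_young_tableaux qs"
      using T(3,4) D(1) by (auto simp: standard_young_tableaux_def)
    moreover have "T = ?U(c := sum_list ps)"
      using T(1) Tc D by (auto simp: fun_eq_iff extensional_def)
    ultimately show "T \<in> (\<lambda>T. T(c := sum_list ps)) ` standard_young_tableaux qs" by blast
  next
    fix U assume "U \<in> (\<lambda>T. T(c := sum_list ps)) ` standard_young_tableaux qs"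
    then obtain T where U: "U = T(c := sum_list ps)" and "T \<in> standard_young_tableaux qs" by blast
    then have T: "T \<in> extensional (young_diagram qs)" "bij_betw T (young_diagram qs) {1..sum_list qs}"
      "\<And>i j j'. (i, j) \<in> young_diagram qs \<Longrightarrow> (i, j') \<in> young_diagram qs \<Longrightarrow> j < j' \<Longrightarrow> T (i, j) < T (i, j')"
      "\<And>i i' j. (i, j) \<in> young_diagram qs \<Longrightarrow> (i', j) \<in> young_diagram qs \<Longrightarrow> i < i' \<Longrightarrow> T (i, j) < T (i', j)"
      by (auto simp: standard_young_tableaux_def)
    have less: "T d < sum_list ps" if "d \<in> young_diagram qs" for d
      using bij_betw_apply[OF T(2) that] n by simp
    have UD: "U d = T d" if "d \<in> young_diagram qs" for d using that D U by auto
    have Uc: "U c = sum_list ps" by (simp add: U)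
    have "bij_betw U (young_diagram qs) {1..sum_list qs}"
      using T(2) UD by (simp cong: bij_betw_cong)
    then have "bij_betw U (young_diagram qs \<union> {c}) ({1..sum_list qs} \<union> {U c})"
      by (rule notIn_Un_bij_betw[rotated 2]) (use D n Uc in auto)
    moreover have "{1..sum_list qs} \<union> {U c} = {1..sum_list ps}" using n Uc by auto
    ultimately have "bij_betw U (young_diagram ps) {1..sum_list ps}" using D by simp
    moreover have "U \<in> extensional (young_diagram ps)"
      using T(1) U D by (auto simp: extensional_def)
    moreover have "U (i, j) < U (i, j')"
      if "(i, j) \<in> young_diagram ps" "(i, j') \<in> young_diagram ps" "j < j'" for i j j'
    proof -
      have "(i, j) \<noteq> c" using that c_max[of j'] D by auto
      then show ?thesis using that T(3)[of i j j'] less[of "(i, j)"] UD Uc D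
        by (cases "(i, j') = c") auto
    qed
    moreover have "U (i, j) < U (i', j)"
      if "(i, j) \<in> young_diagram ps" "(i', j) \<in> young_diagram ps" "i < i'" for i i' j
    proof -
      have "(i, j) \<noteq> c" using that c_max'[of i'] D by auto
      then show ?thesis using that T(4)[of i j i'] less[of "(i, j)"] UD Uc D
        by (cases "(i', j) = c") auto
    qed
    ultimately show "U \<in> {T \<in> standard_young_tableaux ps. T c = sum_list ps}"
      using Uc by (auto simp: standard_young_tableaux_def)
  qed
qed

text \<open>A cell to the right of the largest entry or below it would need a larger entry.\<close>

lemma standard_young_tableaux_max_at_corner:
  assumes ps: "ps \<in> partitions" "ps \<noteq> []" and T: "T \<in> standard_young_tableaux ps"
  obtains i where "i \<in> corner_rows ps" "T (i, row ps i - 1) = sum_list ps"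
proof -
  have bij: "bij_betw T (young_diagram ps) {1..sum_list ps}"
    and inc: "\<And>i j j'. (i, j) \<in> young_diagram ps \<Longrightarrow> (i, j') \<in> young_diagram ps \<Longrightarrow> j < j' \<Longrightarrow> T (i, j) < T (i, j')"
      "\<And>i i' j. (i, j) \<in> young_diagram ps \<Longrightarrow> (i', j) \<in> young_diagram ps \<Longrightarrow> i < i' \<Longrightarrow> T (i, j) < T (i', j)"
    using T by (auto simp: standard_young_tableaux_def)
  have "0 < sum_list ps" using ps by (cases ps) (auto simp: partitions_def)
  then have "sum_list ps \<in> T ` young_diagram ps" using bij by (simp add: bij_betw_def)
  then obtain i j where ij: "(i, j) \<in> young_diagram ps" "T (i, j) = sum_list ps" by auto
  have max: "\<not> T (i, j) < T d" if "d \<in> young_diagram ps" for d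
    using bij_betw_apply[OF bij that] ij by simp
  have "\<not> Suc j < row ps i"
    using inc(1)[OF ij(1), of "Suc j"] max by (auto simp: mem_young_diagram)
  then have j: "j = row ps i - 1" "0 < row ps i" using ij(1) by (auto simp: mem_young_diagram)
  have "\<not> j < row ps (Suc i)"
    using inc(2)[OF ij(1), of "Suc i"] max by (auto simp: mem_young_diagram)
  then have "i \<in> corner_rows ps" using j by (simp add: corner_rows_def)
  then show thesis using that ij j by simp
qed

text \<open>Tableaux are classified by the corner holding the largest entry; injectivity keeps the
  classes disjoint.\<close>

lemma num_syt_rec:
  assumes "ps \<in> partitions" "ps \<noteq> []"
  shows "num_syt ps = (\<Sum>i\<in>corner_rows ps. num_syt (remove_corner ps i))"
proof -
  let ?c = "\<lambda>i. (i, row ps i - 1)"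
  let ?A = "\<lambda>i. {T \<in> standard_young_tableaux ps. T (?c i) = sum_list ps}"
  have "standard_young_tableaux ps = (\<Union>i\<in>corner_rows ps. ?A i)"
    using standard_young_tableaux_max_at_corner[OF assms] by blast
  then have "num_syt ps = card (\<Union>i\<in>corner_rows ps. ?A i)" by (simp add: num_syt_def)
  also have "\<dots> = (\<Sum>i\<in>corner_rows ps. card (?A i))"
  proof (rule card_UN_disjoint)
    show "\<forall>i\<in>corner_rows ps. \<forall>j\<in>corner_rows ps. i \<noteq> j \<longrightarrow> ?A i \<inter> ?A j = {}"
    proof (intro ballI impI, rule ccontr)
      fix i j assume ij: "i \<in> corner_rows ps" "j \<in> corner_rows ps" "i \<noteq> j" "?A i \<inter> ?A j \<noteq> {}"
      then obtain T where "T \<in> standard_young_tableaux ps" "T (?c i) = T (?c j)"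
        by (auto simp: disjoint_iff)
      then have "inj_on T (young_diagram ps)" "T (?c i) = T (?c j)"
        by (auto simp: standard_young_tableaux_def bij_betw_def)
      moreover have "?c i \<in> young_diagram ps" "?c j \<in> young_diagram ps"
        using ij by (auto simp: mem_young_diagram corner_rows_def)
      ultimately show False using ij(3) by (auto dest: inj_onD)
    qed
  qed auto
  also have "\<dots> = (\<Sum>i\<in>corner_rows ps. num_syt (remove_corner ps i))"
  proof (rule sum.cong)
    fix i assume i: "i \<in> corner_rows ps"
    have "inj_on (\<lambda>T. T(?c i := sum_list ps)) (standard_young_tableaux (remove_corner ps i))"
    proof (rule inj_onI, rule ext)
      fix T U d
      assume *: "T \<in> standard_young_tableaux (remove_corner ps i)"
        "U \<in> standard_young_tableaux (remove_corner ps i)"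
        "T(?c i := sum_list ps) = U(?c i := sum_list ps)"
      show "T d = U d"
      \<comment> \<open>The overwritten cell lies outside the smaller diagram, where both fillings
        are \<open>undefined\<close>, so no information is lost there.\<close>
      proof (cases "d = ?c i")
        case True
        then show ?thesis
          using *(1,2) young_diagram_remove_corner(2)[OF assms(1) i]
          by (auto simp: standard_young_tableaux_def extensional_def)
      next
        case False
        then show ?thesis using fun_cong[OF *(3), of d] by simp
      qed
    qed
    then show "card (?A i) = num_syt (remove_corner ps i)"
      unfolding standard_young_tableaux_corner[OF assms(1) i] num_syt_def by (rule card_image)
  qed simp
  finally show ?thesis .
qed

lemma num_syt_Nil: "num_syt [] = 1"
proof -
  have "standard_young_tableaux [] = {\<lambda>_. undefined}"
    by (auto simp: standard_young_tableaux_def young_diagram_def bij_betw_def)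
  then show ?thesis by (simp add: num_syt_def)
qed

section \<open>Beta numbers of a partition\<close>

text \<open>The added staircase makes the weakly decreasing rows strictly decreasing for
  \<open>i < r\<close>, so a set can record them.\<close>

definition bead :: "nat \<Rightarrow> nat list \<Rightarrow> nat \<Rightarrow> nat" where
  "bead r ps i = row ps i + (r - 1 - i)"

definition bead_set :: "nat \<Rightarrow> nat list \<Rightarrow> nat set" where
  "bead_set r ps = bead r ps ` {..<r}"

lemma finite_bead_set [simp]: "finite (bead_set r ps)"
  by (simp add: bead_set_def)

lemma bead_less:
  assumes "ps \<in> partitions" "i < j" "j < r"
  shows "bead r ps j < bead r ps i"
  using row_antimono[OF assms(1), of i j] assms by (simp add: bead_def)

lemma bead_eq_iff:
  assumes "ps \<in> partitions" "i < r" "j < r"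
  shows "bead r ps i = bead r ps j \<longleftrightarrow> i = j"
  using bead_less[OF assms(1)] assms by (metis nat_neq_iff)

lemma inj_on_bead:
  assumes "ps \<in> partitions" "length ps \<le> r"
  shows "inj_on (bead r ps) (corner_rows ps)"
proof (rule inj_onI)
  fix i j assume "i \<in> corner_rows ps" "j \<in> corner_rows ps" "bead r ps i = bead r ps j"
  moreover from this have "i < r" "j < r" using corner_rows_subset[of ps] assms(2) by auto
  ultimately show "i = j" using bead_eq_iff[OF assms(1)] by blast
qed

lemma bead_in_bead_set: "i < r \<Longrightarrow> bead r ps i \<in> bead_set r ps"
  by (simp add: bead_set_def)

text \<open>The staircase contributes exactly the minimal sum that \<open>bead_size\<close>
  subtracts.\<close>

lemma bead_size_bead_set:
  assumes "ps \<in> partitions" "length ps \<le> r"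
  shows "bead_size (bead_set r ps) = sum_list ps"
proof -
  have inj: "inj_on (bead r ps) {..<r}" using bead_eq_iff[OF assms(1)] by (auto simp: inj_on_def)
  have "\<Sum>(bead_set r ps) = (\<Sum>i<r. row ps i) + (\<Sum>i<r. r - 1 - i)"
    unfolding bead_set_def sum.reindex[OF inj] by (simp only: bead_def comp_def sum.distrib)
  also have "(\<Sum>i<r. r - 1 - i) = \<Sum>{..<r}"
    using sum.nat_diff_reindex[of "\<lambda>i. i" r] by simp
  also have "(\<Sum>i<r. row ps i) = (\<Sum>i<length ps. row ps i)"
    using assms(2) by (intro sum.mono_neutral_right) (auto simp: row_def)
  also have "\<dots> = sum_list ps"
    by (simp add: row_def sum_list_sum_nth atLeast0LessThan)
  finally show ?thesis
    using card_image[OF inj] by (simp add: bead_size_def bead_set_def)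
qed

text \<open>A bead is blocked by its successor exactly when the next row is equally long.\<close>

lemma slidable_1_bead_set:
  assumes ps: "ps \<in> partitions" "length ps \<le> r"
  shows "slidable 1 (bead_set r ps) = bead r ps ` corner_rows ps"
proof (intro equalityI subsetI)
  fix x assume "x \<in> slidable 1 (bead_set r ps)"
  then obtain i where i: "i < r" "x = bead r ps i" "1 \<le> x" "x - 1 \<notin> bead_set r ps"
    by (auto simp: slidable_def bead_set_def)
  have "row ps (Suc i) < row ps i"
  proof (rule ccontr)
    assume "\<not> row ps (Suc i) < row ps i"
    then have eq: "row ps (Suc i) = row ps i" using row_antimono[OF ps(1), of i "Suc i"] by simp
    \<comment> \<open>Otherwise \<open>i\<close> is the last bead and its row is empty, so it sits
      at 0 and cannot slide.\<close>
    have "Suc i < r"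
    proof (rule ccontr)
      assume "\<not> Suc i < r"
      then have "row ps (Suc i) = 0" using ps(2) by (simp add: row_def)
      then show False using eq i \<open>\<not> Suc i < r\<close> by (simp add: bead_def)
    qed
    then have "x - 1 = bead r ps (Suc i)" using eq i by (simp add: bead_def)
    then show False using i bead_in_bead_set[OF \<open>Suc i < r\<close>] by simp
  qed
  then show "x \<in> bead r ps ` corner_rows ps" using i by (simp add: corner_rows_def)
next
  fix x assume "x \<in> bead r ps ` corner_rows ps"
  then obtain i where i: "row ps (Suc i) < row ps i" "x = bead r ps i"
    by (auto simp: corner_rows_def)
  then have ir: "i < r" using ps by (auto simp: row_def split: if_splits)
  \<comment> \<open>Earlier beads are at least \<open>x\<close>; later ones lose at least 1 in the
    row and 1 in the staircase, so they are below \<open>x - 1\<close>.\<close>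
  have "x - 1 \<noteq> bead r ps j" if "j < r" for j
  proof (cases "j \<le> i")
    case True
    then have "bead r ps i \<le> bead r ps j"
      using bead_less[OF ps(1), of j i r] ir by (cases "j = i") auto
    then show ?thesis using i by (simp add: bead_def)
  next
    case False
    then have "row ps j \<le> row ps (Suc i)" by (intro row_antimono[OF ps(1)]) simp
    then show ?thesis using i False that by (simp add: bead_def)
  qed
  then show "x \<in> slidable 1 (bead_set r ps)"
    using i ir by (auto simp: slidable_def bead_set_def bead_def)
qed

lemma bead_set_remove_corner:
  assumes ps: "ps \<in> partitions" "length ps \<le> r" and i: "i \<in> corner_rows ps"
  shows "bead_set r (remove_corner ps i) = slide 1 (bead r ps i) (bead_set r ps)"
proof -
  have ir: "i < r" using corner_rows_subset[of ps] i ps(2) by auto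
  have b: "bead r (remove_corner ps i) j = (if j = i then bead r ps i - 1 else bead r ps j)" for j
    using i by (auto simp: bead_def row_remove_corner[OF ps(1) i] corner_rows_def)
  have "bead_set r (remove_corner ps i) =
      insert (bead r (remove_corner ps i) i) (bead r (remove_corner ps i) ` ({..<r} - {i}))"
    unfolding bead_set_def using ir by blast
  also have "\<dots> = insert (bead r ps i - 1) (bead r ps ` ({..<r} - {i}))"
    using b by (intro arg_cong2[where f = insert] image_cong) auto
  also have "bead r ps ` ({..<r} - {i}) = bead_set r ps - {bead r ps i}"
    unfolding bead_set_def using bead_eq_iff[OF ps(1) _ ir] by auto
  finally show ?thesis by (simp add: slide_def)
qed

lemma length_remove_corner_le:
  assumes "ps \<in> partitions" "i \<in> corner_rows ps"
  shows "length (remove_corner ps i) \<le> length ps"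
proof -
  have "row (remove_corner ps i) (length ps) = 0"
    by (simp add: row_remove_corner[OF assms] row_def)
  then show ?thesis using row_eq_0_iff remove_corner_partition[OF assms] by blast
qed

text \<open>The branching rule and the recursion over unit slides agree. One fixed \<open>r\<close>
  serves throughout, since removing a corner never lengthens the list.\<close>

lemma of_nat_num_syt:
  assumes "ps \<in> partitions" "length ps \<le> r"
  shows "of_nat (num_syt ps) = bead_parity (bead_set r ps)"
  using assms
proof (induction "sum_list ps" arbitrary: ps rule: less_induct)
  case less
  show ?case
  proof (cases "ps = []")
    case True
    have "{..<r} = (\<lambda>i. r - 1 - i) ` {..<r}"
    proof (intro equalityI subsetI)
      fix x assume "x \<in> {..<r}"
      then have "x = r - 1 - (r - 1 - x)" "r - 1 - x \<in> {..<r}" by auto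
      then show "x \<in> (\<lambda>i. r - 1 - i) ` {..<r}" by blast
    qed auto
    then have "bead_set r ps = {..<r}" using True by (simp add: bead_set_def bead_def[abs_def] row_def)
    then show ?thesis
      using True num_syt_Nil by (simp add: bead_parity_def bead_size_def)
  next
    case False
    have pos: "0 < sum_list ps" using False less.prems by (cases ps) (auto simp: partitions_def)
    have inj: "inj_on (bead r ps) (corner_rows ps)"
      using less.prems by (rule inj_on_bead)
    have "of_nat (num_syt ps) = (\<Sum>i\<in>corner_rows ps. of_nat (num_syt (remove_corner ps i)) :: bit)"
      by (simp add: num_syt_rec[OF less.prems(1) False])
    also have "\<dots> = (\<Sum>i\<in>corner_rows ps. bead_parity (slide 1 (bead r ps i) (bead_set r ps)))"
    proof (rule sum.cong)
      fix i assume i: "i \<in> corner_rows ps"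
      have "length (remove_corner ps i) \<le> r"
        using length_remove_corner_le[OF less.prems(1) i] less.prems(2) by simp
      then show "of_nat (num_syt (remove_corner ps i)) =
          bead_parity (slide 1 (bead r ps i) (bead_set r ps))"
        using less.hyps[of "remove_corner ps i"] sum_list_remove_corner[OF less.prems(1) i]
          remove_corner_partition[OF less.prems(1) i] bead_set_remove_corner[OF less.prems i] by simp
    qed simp
    also have "\<dots> = slide_sum 1 bead_parity (bead_set r ps)"
      unfolding slide_sum_def slidable_1_bead_set[OF less.prems] using inj by (simp add: sum.reindex)
    also have "\<dots> = bead_parity (bead_set r ps)"
      using bead_parity_power2[of "bead_set r ps" 0] pos bead_size_bead_set[OF less.prems] by simp
    finally show ?thesis .
  qed
qed

section \<open>Odd partitions and their odd lower covers\<close>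

lemma odd_partitions_iff:
  assumes "ps \<in> partitions" "length ps \<le> r"
  shows "ps \<in> odd_partitions \<longleftrightarrow> bead_parity (bead_set r ps) = 1"
proof -
  have "odd (num_syt ps) \<longleftrightarrow> (of_nat (num_syt ps) :: bit) = 1"
    by (cases "even (num_syt ps)") (auto elim!: evenE oddE)
  then show ?thesis using of_nat_num_syt[OF assms] assms(1) by (simp add: odd_partitions_def)
qed

text \<open>Lower covers, corner rows and unit slides correspond. Size 1 is included because the
  tree also needs the edge to the root.\<close>

lemma odd_lower_cover_ex1:
  assumes "ps \<in> odd_partitions" "0 < sum_list ps"
  shows "\<exists>!qs. qs \<in> lower_covers ps \<and> qs \<in> odd_partitions"
proof -
  have ps: "ps \<in> partitions" using assms by (simp add: odd_partitions_def)
  define r where "r = length ps"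
  have r: "length ps \<le> r" by (simp add: r_def)
  have ex1: "\<exists>!x. x \<in> slidable 1 (bead_set r ps) \<and> bead_parity (slide 1 x (bead_set r ps)) = 1"
    using bead_parity_slide_1_ex1[of "bead_set r ps"] assms bead_size_bead_set[OF ps r]
      odd_partitions_iff[OF ps r] by simp
  have odd_iff: "remove_corner ps i \<in> odd_partitions \<longleftrightarrow>
      bead_parity (slide 1 (bead r ps i) (bead_set r ps)) = 1" if i: "i \<in> corner_rows ps" for i
    using odd_partitions_iff[OF remove_corner_partition[OF ps i], of r]
      length_remove_corner_le[OF ps i] bead_set_remove_corner[OF ps r i] by (simp add: r_def)
  show ?thesis
  proof (rule ex_ex1I)
    obtain i where "i \<in> corner_rows ps" "bead_parity (slide 1 (bead r ps i) (bead_set r ps)) = 1"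
      using ex1 unfolding slidable_1_bead_set[OF ps r] by blast
    then show "\<exists>qs. qs \<in> lower_covers ps \<and> qs \<in> odd_partitions"
      unfolding lower_covers_eq[OF ps] using odd_iff by blast
  next
    fix qs qs' assume "qs \<in> lower_covers ps \<and> qs \<in> odd_partitions" "qs' \<in> lower_covers ps \<and> qs' \<in> odd_partitions"
    then obtain i j where i: "i \<in> corner_rows ps" "qs = remove_corner ps i"
        "bead_parity (slide 1 (bead r ps i) (bead_set r ps)) = 1"
      and j: "j \<in> corner_rows ps" "qs' = remove_corner ps j"
        "bead_parity (slide 1 (bead r ps j) (bead_set r ps)) = 1"
      unfolding lower_covers_eq[OF ps] using odd_iff by blast
    then have "bead r ps i = bead r ps j"
      using ex1 unfolding slidable_1_bead_set[OF ps r] by blast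
    then show "qs = qs'" using inj_onD[OF inj_on_bead[OF ps r]] i j by blast
  qed
qed

section \<open>The tree of odd partitions\<close>

lemma nth_cas:
  assumes "pre_digraph.cas G u p v" "i < length p"
  shows "tail G (p ! i) = (if i = 0 then u else head G (p ! (i - 1)))"
  using assms
proof (induction p arbitrary: u i)
  case (Cons e es)
  then show ?case
    by (cases i) (auto simp: pre_digraph.cas.simps)
qed simp

lemma cas_last:
  assumes "pre_digraph.cas G u p v" "p \<noteq> []"
  shows "head G (last p) = v"
  using assms by (induction p arbitrary: u) (auto simp: pre_digraph.cas.simps)

text \<open>A vertex of maximal height on a cycle of length at least 3 would have two distinct parents.\<close>

lemma no_cycle_if_unique_parent:
  fixes G :: "('a, 'b) pre_digraph" and h :: "'a \<Rightarrow> nat"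
  assumes arc: "\<And>e. e \<in> arcs G \<Longrightarrow> parent (tail G e) (head G e) \<or> parent (head G e) (tail G e)"
    and h: "\<And>u v. parent u v \<Longrightarrow> h u < h v"
    and unique: "\<And>u u' v. u \<in> verts G \<Longrightarrow> u' \<in> verts G \<Longrightarrow> v \<in> verts G \<Longrightarrow> parent u v \<Longrightarrow> parent u' v \<Longrightarrow> u = u'"
    and wf: "wf_digraph G"
    and cyc: "pre_digraph.cycle G p" and len: "3 \<le> length p"
  shows False
proof -
  obtain u where walk: "pre_digraph.awalk G u p u" and dist: "distinct (tl (pre_digraph.awalk_verts G u p))"
    using cyc by (auto simp: pre_digraph.cycle_def)
  have cas: "pre_digraph.cas G u p u" and arcs: "set p \<subseteq> arcs G"
    using walk by (auto simp: pre_digraph.awalk_def)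
  define n where "n = length p"
  define w where "w i = head G (p ! i)" for i
  \<comment> \<open>Without its first vertex, the vertex list of the walk consists of the heads of
    its arcs.\<close>
  have dist: "distinct (map (head G) p)"
    using dist len pre_digraph.awalk_verts_conv'[OF cas] by (auto split: if_splits)
  have w_inj: "i = j" if "i < n" "j < n" "w i = w j" for i j
    using that dist nth_eq_iff_index_eq[OF dist, of i j] by (simp add: n_def w_def)
  have u: "u = w (n - 1)"
    using cas_last[OF cas] len by (cases "p = []") (auto simp: w_def n_def last_conv_nth)
  \<comment> \<open>The cyclic predecessor: the walk is closed, so arc 0 starts at the head of the
    last arc.\<close>
  define prev where "prev i = (if i = 0 then n - 1 else i - 1)" for i
  have arc': "(parent (w (prev i)) (w i) \<or> parent (w i) (w (prev i))) \<and> w i \<in> verts G" if "i < n" for i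
  proof -
    have e: "p ! i \<in> arcs G" using that arcs by (auto simp: n_def)
    have "tail G (p ! i) = w (prev i)" using nth_cas[OF cas, of i] that u by (auto simp: n_def w_def prev_def)
    then show ?thesis using arc[OF e] wf_digraph.head_in_verts[OF wf e] by (simp add: w_def)
  qed
  obtain i where i: "i < n" "\<And>j. j < n \<Longrightarrow> h (w j) \<le> h (w i)"
  proof -
    have "Max ((\<lambda>k. h (w k)) ` {..<n}) \<in> (\<lambda>k. h (w k)) ` {..<n}"
      using len by (intro Max_in) (auto simp: n_def lessThan_empty_iff)
    then obtain k where "k < n" "h (w k) = Max ((\<lambda>k. h (w k)) ` {..<n})" by auto
    then show thesis using that[of k] by simp
  qed
  \<comment> \<open>\<open>j\<close> is the cyclic successor of the highest vertex \<open>i\<close>;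
    length at least 3 separates it from \<open>prev i\<close>.\<close>
  define j where "j = (if Suc i = n then 0 else Suc i)"
  have j: "j < n" "prev j = i" "prev i < n" "prev i \<noteq> j"
    using i len by (auto simp: j_def prev_def n_def)
  have "parent (w (prev i)) (w i)"
    using arc'[OF i(1)] i(2)[OF j(3)] h by (metis not_less)
  moreover have "parent (w j) (w i)"
    using arc'[OF j(1)] i(2)[OF j(1)] h j(2) by (metis not_less)
  ultimately have "w (prev i) = w j"
    using unique arc' i(1) j(1,3) by blast
  then show False using w_inj j by blast
qed

section \<open>The graph induced by the odd partitions\<close>

lemma lower_covers_sum_list:
  assumes "ps \<in> partitions" "qs \<in> lower_covers ps"
  shows "sum_list ps = Suc (sum_list qs)"
  using assms sum_list_remove_corner by (auto simp: lower_covers_eq)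

lemma odd_partitions_subset: "odd_partitions \<subseteq> partitions"
  by (auto simp: odd_partitions_def)

lemma Nil_in_odd_partitions: "[] \<in> odd_partitions"
  by (simp add: odd_partitions_def num_syt_Nil partitions_def)

abbreviation (input) odd_graph :: "(nat list, nat list \<times> nat list) pre_digraph" where
  "odd_graph \<equiv> young_graph \<restriction> odd_partitions"

lemma arcs_odd_graph:
  "arcs odd_graph = {(ps, qs). ps \<in> odd_partitions \<and> qs \<in> odd_partitions \<and>
     (ps \<in> lower_covers qs \<or> qs \<in> lower_covers ps)}"
  using odd_partitions_subset by (auto simp: young_graph_def)

lemma odd_graph_simps: "verts odd_graph = odd_partitions" "tail odd_graph = fst" "head odd_graph = snd"
  by (simp_all add: young_graph_def)

lemma wf_odd_graph: "wf_digraph odd_graph"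
  by unfold_locales (auto simp: arcs_odd_graph odd_graph_simps)

lemma symmetric_odd_graph: "symmetric odd_graph"
  unfolding symmetric_conv arcs_odd_graph odd_graph_simps by force

lemma not_lower_cover_self: "ps \<notin> lower_covers ps"
  by (simp add: lower_covers_def young_less_def)

text \<open>Passing repeatedly to an odd lower cover lowers the size by one each time.\<close>

lemma reachable_Nil:
  assumes "ps \<in> odd_partitions"
  shows "ps \<rightarrow>\<^sup>*\<^bsub>odd_graph\<^esub> []"
  using assms
proof (induction "sum_list ps" arbitrary: ps rule: less_induct)
  case less
  interpret wf_digraph odd_graph by (rule wf_odd_graph)
  show ?case
  proof (cases "ps = []")
    case True
    then show ?thesis using less.prems by (simp add: odd_graph_simps)
  next
    case False
    have ps: "ps \<in> partitions" using less.prems odd_partitions_subset by blast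
    then have "0 < sum_list ps" using False by (cases ps) (auto simp: partitions_def)
    then obtain qs where qs: "qs \<in> lower_covers ps" "qs \<in> odd_partitions"
      using odd_lower_cover_ex1[OF less.prems] by blast
    then have "(ps, qs) \<in> arcs_ends odd_graph"
      using less.prems unfolding arcs_ends_conv arcs_odd_graph odd_graph_simps by force
    moreover have "qs \<rightarrow>\<^sup>*\<^bsub>odd_graph\<^esub> []"
      using less.hyps[of qs] lower_covers_sum_list[OF ps qs(1)] qs(2) by simp
    ultimately show ?thesis by (rule adj_reachable_trans)
  qed
qed

theorem theorem3p1:
  shows "(\<forall>ps\<in>odd_partitions. sum_list ps > 1 \<longrightarrow>
            (\<exists>!qs. qs \<in> lower_covers ps \<and> qs \<in> odd_partitions)) \<and>
         rooted_tree (young_graph \<restriction> odd_partitions) []"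
proof (intro conjI ballI impI)
  fix ps assume "ps \<in> odd_partitions" "sum_list ps > 1"
  then show "\<exists>!qs. qs \<in> lower_covers ps \<and> qs \<in> odd_partitions"
    using odd_lower_cover_ex1 by simp
next
  interpret wf_digraph odd_graph by (rule wf_odd_graph)
  have "loopfree_digraph odd_graph"
    by (unfold_locales, unfold arcs_odd_graph odd_graph_simps) (auto simp: not_lower_cover_self)
  moreover have "nomulti_digraph odd_graph"
    by (unfold_locales, unfold arc_to_ends_def odd_graph_simps) auto
  moreover have "connected odd_graph"
    unfolding connected_def
  proof (rule strongly_connectedI)
    show "verts (with_proj (mk_symmetric odd_graph)) \<noteq> {}"
      using Nil_in_odd_partitions by (auto simp: mk_symmetric_def odd_graph_simps)
    fix ps qs
    assume "ps \<in> verts (with_proj (mk_symmetric odd_graph))" "qs \<in> verts (with_proj (mk_symmetric odd_graph))"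
    then have "ps \<rightarrow>\<^sup>*\<^bsub>odd_graph\<^esub> []" "qs \<rightarrow>\<^sup>*\<^bsub>odd_graph\<^esub> []"
      using reachable_Nil by (auto simp: mk_symmetric_def odd_graph_simps)
    \<comment> \<open>The path from \<open>qs\<close> to the root is reversed by symmetry and
      appended.\<close>
    then have "ps \<rightarrow>\<^sup>*\<^bsub>odd_graph\<^esub> qs"
      using symmetric_reachable[OF symmetric_odd_graph] reachable_trans by blast
    then show "ps \<rightarrow>\<^sup>*\<^bsub>with_proj (mk_symmetric odd_graph)\<^esub> qs"
      by (rule reachable_mk_symmetricI)
  qed
  moreover have "\<not> (\<exists>p. pre_digraph.cycle odd_graph p \<and> 3 \<le> length p)"
  proof clarify
    fix p assume p: "pre_digraph.cycle odd_graph p" "3 \<le> length p"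
    \<comment> \<open>The height condition ranges over all pairs, so the relation itself records
      that the child is a partition.\<close>
    let ?parent = "\<lambda>qs ps. qs \<in> lower_covers ps \<and> ps \<in> odd_partitions"
    show False
    proof (rule no_cycle_if_unique_parent[where parent = ?parent and h = sum_list, OF _ _ _ wf_odd_graph p])
      show "?parent (tail odd_graph e) (head odd_graph e) \<or> ?parent (head odd_graph e) (tail odd_graph e)"
        if "e \<in> arcs odd_graph" for e
        using that unfolding arcs_odd_graph odd_graph_simps by auto
      show "sum_list qs < sum_list ps" if "?parent qs ps" for qs ps
        using that lower_covers_sum_list odd_partitions_subset by fastforce
      show "qs = rs" if "qs \<in> verts odd_graph" "rs \<in> verts odd_graph" "?parent qs ps" "?parent rs ps"
        for qs rs ps
      proof -
        have "0 < sum_list ps" using that lower_covers_sum_list odd_partitions_subset by fastforce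
        then show ?thesis
          using odd_lower_cover_ex1[of ps] that unfolding odd_graph_simps by blast
      qed
    qed
  qed
  ultimately show "rooted_tree odd_graph []"
    using symmetric_odd_graph Nil_in_odd_partitions by (auto simp: rooted_tree_def undirected_tree_def odd_graph_simps)
qed

end
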